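(* There exist $0/1$ matrices $M$ with $\mathrm{fool}(M)\ge \mathrm{rank}(M)^{2-o(1)}$; precisely, there exist square $0/1$ matrices $M_1,M_2,\dots$ with $\mathrm{rank}(M_t)\to\infty$ and a function $\varepsilon$ with $\varepsilon(t)\to 0$ as $t\to\infty$ such that $\mathrm{fool}(M_t)\ge \mathrm{rank}(M_t)^{2-\varepsilon(t)}$ for all $t$.
   Context: For an $n\times n$ $0/1$ matrix $M$, $\mathrm{rank}(M)$ is its rank over the reals. A set $S\subseteq[n]\times[n]$ is a fooling set for $M$ if there is $z\in\{0,1\}$ such that (1) $M_{k,\ell}=z$ for every $(k,\ell)\in S$, and (2) for any distinct $(k_1,\ell_1),(k_2,\ell_2)\in S$, $M_{k_1,\ell_2}\ne z$ or $M_{k_2,\ell_1}\ne z$. $\mathrm{fool}(M)$ is the largest size of a fooling set for $M$. *)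

theory Defs
  imports "HOL-Analysis.Analysis" "Jordan_Normal_Form.DL_Rank"
begin

text \<open>Rows and columns are indexed from 0, as usual for \<^typ>\<open>real mat\<close>.\<close>

definition zero_one_mat :: "real mat \<Rightarrow> bool" where
  "zero_one_mat M \<longleftrightarrow> (\<forall>k<dim_row M. \<forall>l<dim_col M. M $$ (k, l) \<in> {0, 1})"

definition fooling_set :: "real mat \<Rightarrow> (nat \<times> nat) set \<Rightarrow> bool" where
  "fooling_set M S \<longleftrightarrow>
     S \<subseteq> {..<dim_row M} \<times> {..<dim_col M} \<and>
     (\<exists>z\<in>{0, 1}.
        (\<forall>(k, l)\<in>S. M $$ (k, l) = z) \<and>
        (\<forall>(k1, l1)\<in>S. \<forall>(k2, l2)\<in>S. (k1, l1) \<noteq> (k2, l2) \<longrightarrow>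
           M $$ (k1, l2) \<noteq> z \<or> M $$ (k2, l1) \<noteq> z))"

definition fool :: "real mat \<Rightarrow> nat" where
  "fool M = Max {card S | S. fooling_set M S}"

lemma fool_Max_wf:
  "finite {card S | S. fooling_set M S}" "{card S | S. fooling_set M S} \<noteq> {}"
proof -
  have "{card S | S. fooling_set M S} \<subseteq> card ` Pow ({..<dim_row M} \<times> {..<dim_col M})"
    by (auto simp: fooling_set_def)
  then show "finite {card S | S. fooling_set M S}"
    by (rule finite_subset) simp
  have "fooling_set M {}"
    by (auto simp: fooling_set_def)
  then show "{card S | S. fooling_set M S} \<noteq> {}"
    by blast
qed

text \<open>Real rank; the locale parameter of \<^const>\<open>vec_space.rank\<close> is the dimension of the column
  vectors.\<close>

definition real_rank :: "real mat \<Rightarrow> nat" where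
  "real_rank M = vec_space.rank (dim_row M) M"

end

theory Submission
  imports Defs "HOL-Real_Asymp.Real_Asymp"
begin

text \<open>Index rows and columns by pairs \<open>(u, v)\<close> of words of length \<open>k\<close> over \<open>N\<close> letters, so that the
  matrix has size \<open>N ^ (2 * k)\<close>. The entry at \<open>(u, v), (u', v')\<close> is 1 if and only if one of \<open>2 * k\<close>
  mutually exclusive clauses holds, one for each coordinate. The clause of a coordinate \<open>i\<close> of \<open>u\<close>
  says that \<open>u, u'\<close> first differ at \<open>i\<close>, and that \<open>v, v'\<close> restricted to the positions after \<open>i\<close> do
  not satisfy \<open>v < v'\<close> at their first difference. The clause of a coordinate \<open>j\<close> of \<open>v\<close> says that
  \<open>v, v'\<close> first differ at \<open>j\<close>, with \<open>v < v'\<close> there, and that \<open>u, u'\<close> agree from \<open>j\<close> on. Among any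
  two coordinates one inspects the other, which makes the clauses exclusive; each inspects at most
  \<open>k + 1\<close> of the \<open>2 * k\<close> coordinates, so the rank is at most \<open>2 * k * N ^ (k + 1)\<close>. No clause
  holds on the diagonal, and for distinct indices one holds in one of the two orientations, so the
  diagonal is a fooling set. Take \<open>N = 2 * k\<close>.\<close>

section \<open>Rank bounds by counting columns and rows\<close>

lemma (in vec_space) maximal_indpt_cols_exists:
  fixes A :: "'a mat"
  obtains U where "maximal U (\<lambda>T. T \<subseteq> set (cols A) \<and> lin_indpt T)"
  using maximal_exists_superset[of "set (cols A)" "\<lambda>T. T \<subseteq> set (cols A) \<and> lin_indpt T" "{}"]
    finite_lin_indpt2[of "{}"] by auto

lemma (in vec_space) rank_le_card_cols:
  assumes "A \<in> carrier_mat n nc"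
  shows "rank A \<le> card (set (cols A))"
proof -
  obtain U where U: "maximal U (\<lambda>T. T \<subseteq> set (cols A) \<and> lin_indpt T)"
    by (rule maximal_indpt_cols_exists)
  then have "U \<subseteq> set (cols A)" by (simp add: maximal_def)
  then show ?thesis
    unfolding rank_card_indpt[OF assms U] by (simp add: card_mono)
qed

lemma (in vec_space) rank_sum_le:
  assumes "finite C"
  shows "rank (mat n nc (\<lambda>p. \<Sum>c\<in>C. f c p)) \<le> (\<Sum>c\<in>C. rank (mat n nc (f c)))"
  using assms
proof induction
  case empty
  have "mat n nc (\<lambda>p. \<Sum>c\<in>{}. f c p) = 0\<^sub>m n nc" by auto
  then show ?case using rank_0I[of nc] by simp
next
  case (insert c C)
  have "mat n nc (\<lambda>p. \<Sum>c\<in>insert c C. f c p) = mat n nc (f c) + mat n nc (\<lambda>p. \<Sum>c\<in>C. f c p)"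
    using insert.hyps by auto
  then have "rank (mat n nc (\<lambda>p. \<Sum>c\<in>insert c C. f c p))
      \<le> rank (mat n nc (f c)) + rank (mat n nc (\<lambda>p. \<Sum>c\<in>C. f c p))"
    using rank_subadditive[of "mat n nc (f c)" nc "mat n nc (\<lambda>p. \<Sum>c\<in>C. f c p)"] by simp
  then show ?case using insert by simp
qed

text \<open>Column \<open>j\<close> depends on \<open>j\<close> only through \<open>h j\<close>, so
  equal values of \<open>h\<close> give equal columns.\<close>

lemma (in vec_space) rank_factor_le:
  assumes "\<And>i j. i < n \<Longrightarrow> j < nc \<Longrightarrow> f (i, j) = g i (h j)"
  shows "rank (mat n nc f) \<le> card (h ` {..<nc})"
proof -
  have "set (cols (mat n nc f)) \<subseteq> (\<lambda>z. vec n (\<lambda>i. g i z)) ` h ` {..<nc}"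
    using assms by (auto simp: cols_def image_iff intro!: bexI eq_vecI)
  then have "card (set (cols (mat n nc f))) \<le> card ((\<lambda>z. vec n (\<lambda>i. g i z)) ` h ` {..<nc})"
    by (intro card_mono) auto
  also have "\<dots> \<le> card (h ` {..<nc})" by (rule card_image_le) simp
  finally show ?thesis using rank_le_card_cols[of "mat n nc f" nc] by simp
qed

text \<open>A row is determined by its entries in a maximal independent set of columns.\<close>

lemma (in vec_space) zero_one_distinct_rows_le:
  assumes A: "A \<in> carrier_mat n nc"
    and zo: "\<And>i j. i < n \<Longrightarrow> j < nc \<Longrightarrow> A $$ (i, j) \<in> {0, 1}"
    and inj: "inj_on (row A) {..<n}"
  shows "n \<le> 2 ^ rank A"
proof -
  obtain U where U: "maximal U (\<lambda>T. T \<subseteq> set (cols A) \<and> lin_indpt T)"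
    by (rule maximal_indpt_cols_exists)
  then have Usub: "U \<subseteq> set (cols A)" and Uind: "lin_indpt U" by (auto simp: maximal_def)
  have fin: "finite U" using Usub finite_subset by blast
  have colsC: "set (cols A) \<subseteq> carrier_vec n" using A cols_dim by blast
  then have UC: "U \<subseteq> carrier_vec n" using Usub by blast
  have span: "s \<in> span U" if s: "s \<in> set (cols A)" for s
  proof (cases "s \<in> U")
    case True
    then show ?thesis using span_mem[of U] UC by auto
  next
    case False
    have "\<not> lin_indpt (U \<union> {s})"
      using U False s Usub unfolding maximal_def by blast
    then show ?thesis
      using lin_dep_iff_in_span[of U s] UC Uind False s colsC by auto
  qed
  have eq: "i = i'" if i: "i < n" "i' < n" and agree: "\<And>u. u \<in> U \<Longrightarrow> u $ i = u $ i'" for i i'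
  proof -
    have "A $$ (i, j) = A $$ (i', j)" if j: "j < nc" for j
    proof -
      have "col A j \<in> set (cols A)" using A j by (auto simp: cols_def)
      then have "col A j \<in> span U" by (rule span)
      then obtain a where a: "col A j = lincomb a U"
        using finite_span[OF fin] UC by auto
      have "col A j $ i = col A j $ i'"
        unfolding a using lincomb_index[OF i(1) UC] lincomb_index[OF i(2) UC] agree by simp
      then show ?thesis using A i j by simp
    qed
    then have "row A i = row A i'" using A i by (intro eq_vecI) auto
    then show ?thesis using inj i by (auto dest: inj_onD)
  qed
  have U01: "vec_index u i \<in> {0, 1}" if u: "u \<in> U" and i: "i < n" for u i
  proof -
    obtain j where "j < nc" "u = col A j" using u Usub A by (auto simp: cols_def)
    then show ?thesis using zo i A by auto
  qed
  \<comment> \<open>\<open>U\<close> has \<open>rank A\<close> elements, and a row is encoded by the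
    subset of \<open>U\<close> where it has a 1.\<close>
  have "inj_on (\<lambda>i. {u \<in> U. u $ i = 1}) {..<n}"
  proof (rule inj_onI)
    fix i i' assume i: "i \<in> {..<n}" "i' \<in> {..<n}" and e: "{u \<in> U. u $ i = 1} = {u \<in> U. u $ i' = 1}"
    show "i = i'"
    proof (rule eq)
      fix u assume u: "u \<in> U"
      then have "u $ i = 1 \<longleftrightarrow> u $ i' = 1" using e by blast
      then show "u $ i = u $ i'" using U01[OF u, of i] U01[OF u, of i'] i by auto
    qed (use i in auto)
  qed
  then have "card {..<n} \<le> card (Pow U)"
    by (rule card_inj_on_le) (use fin in auto)
  then show ?thesis
    using rank_card_indpt[OF A U] by (simp add: card_Pow fin)
qed

section \<open>Matrices from ordered biclique partitions\<close>

lemma fool_ge_card: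
  assumes "fooling_set M S"
  shows "card S \<le> fool M"
  unfolding fool_def using assms fool_Max_wf by (intro Max_ge) auto

text \<open>An ordered biclique partition of the complete graph on \<open>X\<close>: clause \<open>c\<close> splits into one
  biclique for each value of \<open>h c\<close>.\<close>

lemma ordered_biclique_partition_matrix:
  fixes F :: "'c \<Rightarrow> 'x \<Rightarrow> 'x \<Rightarrow> bool" and h :: "'c \<Rightarrow> 'x \<Rightarrow> 'x"
  assumes X: "finite X" and C: "finite C"
    and reads: "\<And>c x y. c \<in> C \<Longrightarrow> x \<in> X \<Longrightarrow> y \<in> X \<Longrightarrow> F c x y = F c x (h c y)"
    and few: "\<And>c. c \<in> C \<Longrightarrow> card (h c ` X) \<le> q"
    and disj: "\<And>c d x y. c \<in> C \<Longrightarrow> d \<in> C \<Longrightarrow> x \<in> X \<Longrightarrow> y \<in> X \<Longrightarrow> F c x y \<Longrightarrow> F d x y \<Longrightarrow> c = d"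
    and irrefl: "\<And>c x. c \<in> C \<Longrightarrow> x \<in> X \<Longrightarrow> \<not> F c x x"
    and total: "\<And>x y. x \<in> X \<Longrightarrow> y \<in> X \<Longrightarrow> x \<noteq> y \<Longrightarrow> \<exists>c\<in>C. F c x y \<or> F c y x"
  obtains M where "M \<in> carrier_mat (card X) (card X)" "zero_one_mat M"
    "real_rank M \<le> card C * q" "card X \<le> fool M" "card X \<le> 2 ^ real_rank M"
proof -
  let ?n = "card X"
  obtain e where "bij_betw e {0..<?n} X" using ex_bij_betw_nat_finite[OF X] by blast
  then have e: "bij_betw e {..<?n} X" by (simp add: atLeast0LessThan)
  have eX: "e i \<in> X" if "i < ?n" for i using e that by (auto simp: bij_betw_def)
  have e_inj: "e i = e j \<longleftrightarrow> i = j" if "i < ?n" "j < ?n" for i j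
    using e that by (auto simp: bij_betw_def dest: inj_onD)
  define f where "f = (\<lambda>c (i, j). of_bool (F c (e i) (e j)) :: real)"
  define M where "M = mat ?n ?n (\<lambda>p. \<Sum>c\<in>C. f c p)"
  have M: "M \<in> carrier_mat ?n ?n" by (simp add: M_def)
  \<comment> \<open>By \<open>disj\<close> at most one summand is nonzero, so the sum stays in {0,
    1}.\<close>
  have entry: "M $$ (i, j) = of_bool (\<exists>c\<in>C. F c (e i) (e j))" if "i < ?n" "j < ?n" for i j
  proof (cases "\<exists>c\<in>C. F c (e i) (e j)")
    case True
    then obtain c where c: "c \<in> C" "F c (e i) (e j)" by blast
    have "F d (e i) (e j) \<longleftrightarrow> d = c" if "d \<in> C" for d
      using disj[of d c "e i" "e j"] c that eX \<open>i < ?n\<close> \<open>j < ?n\<close> by auto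
    then have "(\<Sum>d\<in>C. f d (i, j)) = (\<Sum>d\<in>C. if d = c then 1 else 0)"
      by (intro sum.cong) (auto simp: f_def)
    also have "\<dots> = 1" using c C by simp
    finally show ?thesis using that True by (simp add: M_def)
  next
    case False
    then show ?thesis using that by (simp add: M_def f_def)
  qed
  have zo: "zero_one_mat M" using M entry by (auto simp: zero_one_mat_def)
  have diag: "M $$ (i, i) = 0" if "i < ?n" for i
    using entry[OF that that] irrefl eX[OF that] by auto
  have off: "M $$ (i, j) = 1 \<or> M $$ (j, i) = 1" if "i < ?n" "j < ?n" "i \<noteq> j" for i j
    using entry that total[of "e i" "e j"] e_inj eX by auto
  interpret vec_space "TYPE(real)" ?n .
  have rank: "real_rank M = rank M" using M by (simp add: real_rank_def)
  have "rank (mat ?n ?n (f c)) \<le> q" if c: "c \<in> C" for c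
  proof -
    have "rank (mat ?n ?n (f c)) \<le> card ((\<lambda>j. h c (e j)) ` {..<?n})"
      by (rule rank_factor_le[where g = "\<lambda>i z. of_bool (F c (e i) z)"])
        (use reads[OF c] eX in \<open>auto simp: f_def\<close>)
    also have "(\<lambda>j. h c (e j)) ` {..<?n} = h c ` X"
      using e by (auto simp: bij_betw_def image_image[symmetric])
    finally show ?thesis using few[OF c] by simp
  qed
  then have "rank M \<le> card C * q"
    using rank_sum_le[OF C, of ?n f] sum_bounded_above[of C "\<lambda>c. rank (mat ?n ?n (f c))" q]
    unfolding M_def by simp
  moreover have "card X \<le> fool M"
  proof -
    have "fooling_set M ((\<lambda>i. (i, i)) ` {..<?n})"
      unfolding fooling_set_def
    proof (intro conjI bexI[of _ 0])
      show "\<forall>(k1, l1)\<in>(\<lambda>i. (i, i)) ` {..<?n}. \<forall>(k2, l2)\<in>(\<lambda>i. (i, i)) ` {..<?n}.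
          (k1, l1) \<noteq> (k2, l2) \<longrightarrow> M $$ (k1, l2) \<noteq> 0 \<or> M $$ (k2, l1) \<noteq> 0"
        using off by force
    qed (use M diag in auto)
    moreover have "card ((\<lambda>i. (i, i)) ` {..<?n}) = ?n"
      by (subst card_image) (auto simp: inj_on_def)
    ultimately show ?thesis using fool_ge_card by fastforce
  qed
  moreover have "card X \<le> 2 ^ rank M"
  proof (rule zero_one_distinct_rows_le[OF M])
    show "inj_on (row M) {..<?n}"
    proof (rule inj_onI)
      fix i j assume ij: "i \<in> {..<?n}" "j \<in> {..<?n}" and eq: "row M i = row M j"
      \<comment> \<open>With equal rows, the zero diagonal forces the entries at
        \<open>(i, j)\<close> and \<open>(j, i)\<close> to be 0, which \<open>off\<close> excludes
        unless \<open>i = j\<close>.\<close>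
      have "M $$ (i, l) = M $$ (j, l)" if "l < ?n" for l
        using arg_cong[OF eq, of "\<lambda>v. v $ l"] M ij that by simp
      then show "i = j" using ij diag off by (metis lessThan_iff zero_neq_one)
    qed
  qed (use entry in auto)
  ultimately show ?thesis using that[OF M zo] rank by simp
qed

section \<open>Clauses on pairs of words\<close>

text \<open>The flag tells whether the clause belongs to a coordinate of the first word.\<close>

fun clause :: "nat \<Rightarrow> bool \<times> nat \<Rightarrow> (nat \<Rightarrow> nat) \<times> (nat \<Rightarrow> nat) \<Rightarrow> (nat \<Rightarrow> nat) \<times> (nat \<Rightarrow> nat) \<Rightarrow> bool" where
  "clause k (True, i) (u, v) (u', v') \<longleftrightarrow>
     u i \<noteq> u' i \<and> (\<forall>l<i. u l = u' l) \<and>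
     \<not> (\<exists>j\<in>{i<..<k}. v j < v' j \<and> (\<forall>l\<in>{i<..<j}. v l = v' l))"
| "clause k (False, j) (u, v) (u', v') \<longleftrightarrow>
     v j < v' j \<and> (\<forall>l<j. v l = v' l) \<and> (\<forall>i\<in>{j..<k}. u i = u' i)"

text \<open>Coordinates that the clause does not inspect become \<open>undefined\<close>. The view
  keeps the type of an index, so the clause can be evaluated on it directly.\<close>

fun clause_view :: "nat \<Rightarrow> bool \<times> nat \<Rightarrow> (nat \<Rightarrow> nat) \<times> (nat \<Rightarrow> nat) \<Rightarrow> (nat \<Rightarrow> nat) \<times> (nat \<Rightarrow> nat)" where
  "clause_view k (True, i) (u, v) = (restrict u {..i}, restrict v {i<..<k})"
| "clause_view k (False, j) (u, v) = (restrict u {j..<k}, restrict v {..j})"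

abbreviation words :: "nat \<Rightarrow> nat \<Rightarrow> (nat \<Rightarrow> nat) set" where
  "words k N \<equiv> {..<k} \<rightarrow>\<^sub>E {..<N}"

lemma clause_reads_view: "clause k c x y = clause k c x (clause_view k c y)"
  by (cases "(k, c, x, y)" rule: clause.cases) (auto simp: restrict_def)

text \<open>A clause of the first word inspects (i + 1) + (k - 1 - i) = k coordinates, one of the
  second word (k - i) + (i + 1) = k + 1.\<close>

lemma card_clause_view_image:
  assumes "snd c < k"
  shows "card (clause_view k c ` (words k N \<times> words k N)) \<le> N ^ (k + 1)"
proof -
  obtain b i where c: "c = (b, i)" by (cases c)
  have bound: "card (clause_view k c ` (words k N \<times> words k N)) \<le> N ^ card I * N ^ card J"
    if "finite I" "finite J"
      "clause_view k c ` (words k N \<times> words k N) \<subseteq> (I \<rightarrow>\<^sub>E {..<N}) \<times> (J \<rightarrow>\<^sub>E {..<N})" for I J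
  proof -
    have "card (clause_view k c ` (words k N \<times> words k N))
        \<le> card ((I \<rightarrow>\<^sub>E {..<N}) \<times> (J \<rightarrow>\<^sub>E {..<N}))"
      using that by (intro card_mono finite_cartesian_product finite_PiE) auto
    then show ?thesis using that by (simp add: card_cartesian_product card_PiE)
  qed
  have restr: "restrict w I \<in> I \<rightarrow>\<^sub>E {..<N}" if "w \<in> words k N" "I \<subseteq> {..<k}" for w I
    using that unfolding restrict_PiE_iff by blast
  show ?thesis
  proof (cases b)
    case True
    have "card (clause_view k c ` (words k N \<times> words k N)) \<le> N ^ card {..i} * N ^ card {i<..<k}"
      using assms restr by (intro bound image_subsetI) (auto simp: c True subset_iff)
    also have "\<dots> = N ^ k"
      unfolding power_add[symmetric] using assms by (intro arg_cong[where f = "power N"]) (simp add: c)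
    \<comment> \<open>Since 0 ^ 0 = 1, the case \<open>N = 0\<close> relies on k > 0.\<close>
    also have "\<dots> \<le> N ^ (k + 1)" by (cases "N = 0") (use assms in auto)
    finally show ?thesis .
  next
    case False
    have "card (clause_view k c ` (words k N \<times> words k N)) \<le> N ^ card {i..<k} * N ^ card {..i}"
      using assms restr by (intro bound image_subsetI) (auto simp: c False subset_iff)
    also have "\<dots> = N ^ (k + 1)"
      unfolding power_add[symmetric] using assms by (intro arg_cong[where f = "power N"]) (simp add: c)
    finally show ?thesis .
  qed
qed

text \<open>For equal flags, a first difference is unique. For mixed flags, if i < j then the
  increase of \<open>v\<close> at \<open>j\<close> blocks the clause of \<open>i\<close>; if j \<le>
  i then the clause of \<open>j\<close> forces \<open>u i = u' i\<close>.\<close>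

lemma clause_unique:
  assumes "snd c < k" "snd d < k" "clause k c x y" "clause k d x y"
  shows "c = d"
proof -
  obtain u v u' v' where xy: "x = (u, v)" "y = (u', v')" by (cases x, cases y)
  have mixed: False if "i < k" "j < k" "clause k (True, i) x y" "clause k (False, j) x y" for i j
    using that unfolding xy by (cases "i < j") auto
  obtain a i b j where cd: "c = (a, i)" "d = (b, j)" by (cases c, cases d)
  have "i = j" if "a = b"
    using assms that unfolding cd xy by (cases a; cases i j rule: linorder_cases) auto
  then show ?thesis using mixed assms unfolding cd by (cases a; cases b) auto
qed

lemma first_difference:
  fixes w w' :: "nat \<Rightarrow> nat"
  assumes "i \<in> {a..<k}" "w i \<noteq> w' i"
  obtains j where "j \<in> {a..<k}" "w j \<noteq> w' j" "\<And>l. l \<in> {a..<j} \<Longrightarrow> w l = w' l"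
proof -
  define j where "j = (LEAST j. j \<in> {a..<k} \<and> w j \<noteq> w' j)"
  have j: "j \<in> {a..<k} \<and> w j \<noteq> w' j"
    unfolding j_def by (rule LeastI[of _ i]) (use assms in auto)
  moreover have "w l = w' l" if "l \<in> {a..<j}" for l
    using not_less_Least[of l "\<lambda>j. j \<in> {a..<k} \<and> w j \<noteq> w' j"] that j unfolding j_def by auto
  ultimately show ?thesis using that by blast
qed

text \<open>If \<open>u\<close> and \<open>u'\<close> first differ at \<open>i\<close>, the clause of \<open>i\<close> can only be blocked in one of the two
  orientations, because only the first difference of \<open>v\<close> and \<open>v'\<close> after \<open>i\<close> matters.\<close>

lemma clause_total:
  assumes x: "x \<in> words k N \<times> words k N" and y: "y \<in> words k N \<times> words k N" and "x \<noteq> y"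
  shows "\<exists>c\<in>UNIV \<times> {..<k}. clause k c x y \<or> clause k c y x"
proof -
  obtain u v u' v' where xy: "x = (u, v)" "y = (u', v')" by (cases x, cases y)
  show ?thesis
  proof (cases "\<exists>i\<in>{0..<k}. u i \<noteq> u' i")
    case True
    then obtain i where i: "i \<in> {0..<k}" "u i \<noteq> u' i" "\<And>l. l \<in> {0..<i} \<Longrightarrow> u l = u' l"
      using first_difference by metis
    have "clause k (True, i) x y \<or> clause k (True, i) y x"
    proof (rule ccontr)
      assume "\<not> ?thesis"
      then obtain j j' where
        "j \<in> {i<..<k}" "v j < v' j" "\<forall>l\<in>{i<..<j}. v l = v' l"
        "j' \<in> {i<..<k}" "v' j' < v j'" "\<forall>l\<in>{i<..<j'}. v' l = v l"
        using i unfolding xy by auto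
      then show False by (cases j j' rule: linorder_cases) auto
    qed
    then show ?thesis using i by (intro bexI[of _ "(True, i)"]) auto
  next
    case False
    then have "u = u'"
      using x y PiE_ext[of u "{..<k}" "\<lambda>_. {..<N}" u'] unfolding xy by auto
    then have "v \<noteq> v'" using assms unfolding xy by auto
    then have "\<exists>j\<in>{0..<k}. v j \<noteq> v' j"
      using x y PiE_ext[of v "{..<k}" "\<lambda>_. {..<N}" v'] unfolding xy by auto
    then obtain j where j: "j \<in> {0..<k}" "v j \<noteq> v' j" "\<And>l. l \<in> {0..<j} \<Longrightarrow> v l = v' l"
      using first_difference by metis
    \<comment> \<open>Agreement of \<open>u\<close> and \<open>u'\<close> is automatic here, and the
      order of \<open>v j\<close> and \<open>v' j\<close> picks the orientation.\<close>
    then have "clause k (False, j) x y \<or> clause k (False, j) y x"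
      using \<open>u = u'\<close> unfolding xy by auto
    then show ?thesis using j by (intro bexI[of _ "(False, j)"]) auto
  qed
qed

section \<open>Choice of parameters and asymptotics\<close>

lemma ex_matrix_fool_ge_rank_le:
  fixes k N :: nat
  obtains M where "M \<in> carrier_mat (N ^ (2 * k)) (N ^ (2 * k))" "zero_one_mat M"
    "real_rank M \<le> 2 * k * N ^ (k + 1)" "N ^ (2 * k) \<le> fool M" "N ^ (2 * k) \<le> 2 ^ real_rank M"
proof -
  let ?X = "words k N \<times> words k N" and ?C = "(UNIV :: bool set) \<times> {..<k}"
  have card: "card ?X = N ^ (2 * k)" "card ?C = 2 * k"
    by (simp_all add: card_cartesian_product card_PiE mult_2 power_add)
  show ?thesis
  proof (rule ordered_biclique_partition_matrix[of ?X ?C "clause k" "clause_view k" "N ^ (k + 1)"])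
    show "finite ?X" by (intro finite_cartesian_product finite_PiE) auto
    show "\<not> clause k c x x" for c x
      by (cases "(k, c, x, x)" rule: clause.cases) auto
    show "clause k c x y = clause k c x (clause_view k c y)" for c x y
      by (rule clause_reads_view)
  qed (use that clause_unique clause_total card_clause_view_image in \<open>auto simp: card mem_Times_iff\<close>)
qed

theorem theorem2:
  shows "\<exists>(M :: nat \<Rightarrow> real mat) (\<epsilon> :: nat \<Rightarrow> real).
    (\<forall>t\<ge>1. \<exists>n\<ge>1. M t \<in> carrier_mat n n \<and> zero_one_mat (M t)) \<and>
    filterlim (\<lambda>t. real_rank (M t)) at_top sequentially \<and>
    \<epsilon> \<longlonglongrightarrow> 0 \<and>
    (\<forall>t\<ge>1. real (fool (M t)) \<ge> real (real_rank (M t)) powr (2 - \<epsilon> t))"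
proof -
  \<comment> \<open>This alphabet size absorbs the number of clauses: 2 * t * N ^ (t + 1) = N ^ (t +
    2).\<close>
  define N :: "nat \<Rightarrow> nat" where "N t = 2 * t" for t
  have "\<forall>t. \<exists>M. M \<in> carrier_mat (N t ^ (2 * t)) (N t ^ (2 * t)) \<and> zero_one_mat M \<and>
      real_rank M \<le> 2 * t * N t ^ (t + 1) \<and> N t ^ (2 * t) \<le> fool M \<and>
      N t ^ (2 * t) \<le> 2 ^ real_rank M"
    using ex_matrix_fool_ge_rank_le by metis
  then obtain M where M: "\<And>t. M t \<in> carrier_mat (N t ^ (2 * t)) (N t ^ (2 * t))"
      "\<And>t. zero_one_mat (M t)" "\<And>t. real_rank (M t) \<le> 2 * t * N t ^ (t + 1)"
      "\<And>t. N t ^ (2 * t) \<le> fool (M t)" "\<And>t. N t ^ (2 * t) \<le> 2 ^ real_rank (M t)"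
    by metis
  \<comment> \<open>Solves (t + 2) * (2 - \<epsilon>) = 2 * t, which matches the exponents of the
    rank and fooling set bounds.\<close>
  define \<epsilon> :: "nat \<Rightarrow> real" where "\<epsilon> t = 4 / (real t + 2)" for t
  \<comment> \<open>Rank growth comes from the number of distinct rows, as \<open>N t\<close> is at
    least 2 for positive \<open>t\<close>.\<close>
  have "t \<le> real_rank (M t)" for t
  proof (cases "t = 0")
    case False
    then have "(2::nat) ^ (2 * t) \<le> N t ^ (2 * t)" by (intro power_mono) (auto simp: N_def)
    then have "(2::nat) ^ (2 * t) \<le> 2 ^ real_rank (M t)" using M(5) le_trans by blast
    then have "2 * t \<le> real_rank (M t)" by (subst (asm) power_increasing_iff) auto
    then show ?thesis by simp
  qed simp
  then have "filterlim (\<lambda>t. real_rank (M t)) at_top sequentially"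
    by (intro filterlim_at_top_mono[OF filterlim_ident]) auto
  moreover have "\<epsilon> \<longlonglongrightarrow> 0"
    unfolding \<epsilon>_def by real_asymp
  moreover have "real (real_rank (M t)) powr (2 - \<epsilon> t) \<le> real (fool (M t))" if "t \<ge> 1" for t
  proof -
    have "real_rank (M t) \<le> N t ^ (t + 2)" using M(3)[of t] by (simp add: N_def)
    then have "real (real_rank (M t)) \<le> real (N t) ^ (t + 2)"
      by (metis of_nat_le_iff of_nat_power)
    also have "\<dots> = real (N t) powr (t + 2)"
      using that by (subst powr_realpow[symmetric]) (auto simp: N_def)
    \<comment> \<open>Monotonicity in the base needs a nonnegative exponent: 4 / (t + 2) \<le>
      2.\<close>
    finally have "real (real_rank (M t)) powr (2 - \<epsilon> t)
        \<le> (real (N t) powr (t + 2)) powr (2 - \<epsilon> t)"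
      by (intro powr_mono2) (auto simp: \<epsilon>_def field_simps)
    also have "\<dots> = real (N t) powr (real (t + 2) * (2 - \<epsilon> t))" by (rule powr_powr)
    also have "real (t + 2) * (2 - \<epsilon> t) = real (2 * t)" by (simp add: \<epsilon>_def field_simps)
    also have "real (N t) powr real (2 * t) = real (N t ^ (2 * t))"
      using that by (subst powr_realpow) (auto simp: N_def)
    also have "\<dots> \<le> real (fool (M t))" using M(4) by (simp only: of_nat_le_iff)
    finally show ?thesis .
  qed
  moreover have "\<exists>n\<ge>1. M t \<in> carrier_mat n n \<and> zero_one_mat (M t)" if "t \<ge> 1" for t
    using M(1,2)[of t] that by (intro exI[of _ "N t ^ (2 * t)"]) (auto simp: N_def)
  ultimately show ?thesis by (intro exI[of _ M] exI[of _ \<epsilon>]) auto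
qed

end
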